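(* Let $X\subseteq\mathbb{R}$, with the subspace topology, be such that disjoint closed subsets of $X$ can be separated by clopen subsets of $X$. Then $X$ satisfies $\mathsf{S}_1(\Gamma,\Gamma)$ if, and only if, for each map $\phi:X\to Fr^{\mathbb{N}}$ (not necessarily continuous) such that the multivalued map $\Phi:X\Rightarrow Fr^{\mathbb{N}}$ defined by $$\Phi(x)=\prod_{k\in\mathbb{N}}\bigl(P(\phi(x)(k))\cap Fr\bigr)$$ is lower semi-continuous, there is $f\in\mathbb{N}^{\mathbb{N}}$ such that, for each $x\in X$, $f(k)\in\phi(x)(k)$ for all but finitely many $k$.
   Context: $P(A)$ denotes the power set of $A$. $P(\mathbb{N})$ is topologized by identifying it with the Cantor space $\{0,1\}^{\mathbb{N}}$. $Fr\subseteq P(\mathbb{N})$ is the Fréchet filter, i.e. the set of all cofinite subsets of $\mathbb{N}$, with the subspace topology; $Fr^{\mathbb{N}}$ carries the product topology. A multivalued map $\Phi:X\Rightarrow Y$ is a map $\Phi:X\to P(Y)$. It is lower semi-continuous (lsc) if for each open $V\subseteq Y$ the set $\{x\in X:\Phi(x)\cap V\neq\emptyset\}$ is open in $X$. A family $\mathcal{U}=\{U_n:n\in\mathbb{N}\}$ of subsets of $X$ (taken together with its enumeration) is a $\gamma$-cover of $X$ if for each $x\in X$, $x\in U_n$ for all but finitely many $n$. $\Gamma$ is the collection of all $\gamma$-covers of $X$ by open subsets of $X$. For collections $\mathcal{A},\mathcal{B}$ of families of subsets of $X$, $\mathsf{S}_1(\mathcal{A},\mathcal{B})$ is the property: for each sequence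 $\{\mathcal{U}_n\}_{n\in\mathbb{N}}$ of members of $\mathcal{A}$ there exist members $U_n\in\mathcal{U}_n$, $n\in\mathbb{N}$, such that $\{U_n:n\in\mathbb{N}\}\in\mathcal{B}$. *)

theory Defs
  imports "HOL-Analysis.Analysis"
begin

definition cantor_powerset :: "nat set topology" where
  "cantor_powerset =
     pullback_topology UNIV (\<lambda>A n. n \<in> A)
       (product_topology (\<lambda>n::nat. discrete_topology (UNIV :: bool set)) UNIV)"

definition frechet :: "nat set set" where
  "frechet = {A. finite (- A)}"

definition frechet_space :: "nat set topology" where
  "frechet_space = subtopology cantor_powerset frechet"

definition frechet_power :: "(nat \<Rightarrow> nat set) topology" where
  "frechet_power = product_topology (\<lambda>k::nat. frechet_space) UNIV"

definition lower_semicontinuous ::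
    "'a topology \<Rightarrow> 'b topology \<Rightarrow> ('a \<Rightarrow> 'b set) \<Rightarrow> bool" where
  "lower_semicontinuous X Y \<Phi> \<longleftrightarrow>
     \<Phi> \<in> topspace X \<rightarrow> Pow (topspace Y) \<and>
     (\<forall>V. openin Y V \<longrightarrow> openin X {x \<in> topspace X. \<Phi> x \<inter> V \<noteq> {}})"

text \<open>
  A countable family of sets is represented by its enumeration, so repetitions are allowed and
  ``all but finitely many'' refers to indices.
\<close>

definition gamma_cover :: "'a set \<Rightarrow> (nat \<Rightarrow> 'a set) \<Rightarrow> bool" where
  "gamma_cover X U \<longleftrightarrow> (\<forall>n. U n \<subseteq> X) \<and> (\<forall>x\<in>X. \<forall>\<^sub>\<infinity>n. x \<in> U n)"

definition open_gamma_covers :: "'a topology \<Rightarrow> (nat \<Rightarrow> 'a set) set" where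
  "open_gamma_covers X = {U. gamma_cover (topspace X) U \<and> (\<forall>n. openin X (U n))}"

definition S1 :: "(nat \<Rightarrow> 'a set) set \<Rightarrow> (nat \<Rightarrow> 'a set) set \<Rightarrow> bool" where
  "S1 \<A> \<B> \<longleftrightarrow>
     (\<forall>\<U> :: nat \<Rightarrow> nat \<Rightarrow> 'a set. (\<forall>n. \<U> n \<in> \<A>) \<longrightarrow>
        (\<exists>V :: nat \<Rightarrow> 'a set. (\<forall>n. V n \<in> range (\<U> n)) \<and> V \<in> \<B>))"

definition clopen_separation :: "'a topology \<Rightarrow> bool" where
  "clopen_separation X \<longleftrightarrow>
     (\<forall>A B. closedin X A \<and> closedin X B \<and> A \<inter> B = {} \<longrightarrow>
        (\<exists>C. closedin X C \<and> openin X C \<and> A \<subseteq> C \<and> C \<inter> B = {}))"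

end

theory Submission imports Defs begin

text \<open>
  A map \<open>\<phi>\<close> into \<open>Fr\<^sup>\<nat>\<close> and a sequence of families of sets \<open>U k n\<close> carry the same data, via
  \<open>x \<in> U k n \<longleftrightarrow> n \<in> \<phi> x k\<close>. Under this dictionary, \<open>\<phi> x k\<close> being cofinite for every \<open>x\<close> says that
  \<open>U k\<close> is a \<open>\<gamma>\<close>-cover, and \<open>f k \<in> \<phi> x k\<close> for almost all \<open>k\<close> says that the selection
  \<open>k \<mapsto> U k (f k)\<close> is a \<open>\<gamma>\<close>-cover.

  What remains is to see that lower semicontinuity of \<open>x \<mapsto> \<Prod>\<^sub>k P(\<phi> x k) \<inter> Fr\<close> says exactly that
  all the sets \<open>U k n\<close> are open (\<open>lower_semicontinuous_frechet_subsets_iff\<close>). A nonempty basic open set of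
  \<open>Fr\<^sup>\<nat>\<close> prescribes, at finitely many coordinates, finitely many elements that must belong to the
  set and finitely many that must not. The exclusions cost nothing, because a cofinite
  subset of \<open>\<phi> x k\<close> stays cofinite after deleting finitely many points. So the product at
  \<open>x\<close> meets the basic set iff finitely many conditions \<open>n \<in> \<phi> x k\<close> hold.

  The two sides of the equivalence are thus the same statement in two languages.
\<close>

lemma topspace_frechet_space: "topspace frechet_space = frechet"
  by (simp add: frechet_space_def cantor_powerset_def topspace_pullback_topology)

lemma topspace_frechet_power: "topspace frechet_power = (\<Pi>\<^sub>E k\<in>UNIV. frechet)"
  by (simp add: frechet_power_def topspace_frechet_space)

text \<open>
  Open sets of the Cantor space are unions of cylinders; only finitely many coordinates are
  constrained, so they all lie below some bound \<open>N\<close>.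
\<close>

lemma openin_frechet_space_initial_segment:
  assumes "openin frechet_space U" "A \<in> U"
  obtains N where "\<And>B. B \<in> frechet \<Longrightarrow> B \<inter> {..<N} = A \<inter> {..<N} \<Longrightarrow> B \<in> U"
proof -
  obtain T where T: "openin cantor_powerset T" "U = T \<inter> frechet"
    using assms(1) by (auto simp: frechet_space_def openin_subtopology)
  obtain S where S: "openin (product_topology (\<lambda>n. discrete_topology (UNIV :: bool set)) UNIV) S"
    and TS: "T = (\<lambda>A n. n \<in> A) -` S"
    using T(1) by (auto simp: cantor_powerset_def openin_pullback_topology)
  have "(\<lambda>n. n \<in> A) \<in> S"
    using assms(2) T TS by auto
  then obtain W where W: "finite {i::nat. W i \<noteq> (UNIV :: bool set)}"
      "(\<lambda>n. n \<in> A) \<in> Pi\<^sub>E UNIV W" "Pi\<^sub>E UNIV W \<subseteq> S"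
    using S unfolding openin_product_topology_alt by auto
  obtain N where N: "{i. W i \<noteq> UNIV} \<subseteq> {..<N}"
    using W(1) by (meson finite_nat_iff_bounded)
  show thesis
  proof (rule that[of N])
    fix B assume B: "B \<in> frechet" "B \<inter> {..<N} = A \<inter> {..<N}"
    have "(n \<in> B) \<in> W n" for n
    proof (cases "W n = UNIV")
      case False
      then have "n < N" using N by auto
      then have "(n \<in> B) = (n \<in> A)" using B(2) by auto
      then show ?thesis using PiE_mem[OF W(2) UNIV_I, of n] by simp
    qed simp
    then have "(\<lambda>n. n \<in> B) \<in> Pi\<^sub>E UNIV W"
      by (simp add: PiE_iff)
    with W(3) have "(\<lambda>n. n \<in> B) \<in> S" ..
    then show "B \<in> U"
      using T(2) TS B(1) by simp
  qed
qed

lemma openin_frechet_power_mem: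
  "openin frechet_power {g \<in> topspace frechet_power. n \<in> g k}"
proof -
  have "openin cantor_powerset {A. n \<in> A}"
  proof -
    have "continuous_map cantor_powerset (discrete_topology UNIV) ((\<lambda>g. g n) \<circ> (\<lambda>A n. n \<in> A))"
      unfolding cantor_powerset_def
      by (intro continuous_map_pullback continuous_map_product_projection) simp
    then have "openin cantor_powerset
        {A \<in> topspace cantor_powerset. ((\<lambda>g. g n) \<circ> (\<lambda>A n. n \<in> A)) A \<in> {True}}"
      by (rule openin_continuous_map_preimage) simp
    then show ?thesis
      by (simp add: cantor_powerset_def topspace_pullback_topology)
  qed
  then have "openin frechet_space (frechet \<inter> {A. n \<in> A})"
    by (auto simp: frechet_space_def openin_subtopology)
  then have "openin frechet_power
      {g \<in> topspace frechet_power. g k \<in> frechet \<inter> {A. n \<in> A}}"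
    unfolding frechet_power_def
    by (intro openin_continuous_map_preimage[OF continuous_map_product_projection]) auto
  also have "{g \<in> topspace frechet_power. g k \<in> frechet \<inter> {A. n \<in> A}} =
      {g \<in> topspace frechet_power. n \<in> g k}"
    by (auto simp: topspace_frechet_power)
  finally show ?thesis .
qed

text \<open>
  For the substantial direction, suppose \<open>g\<close> lies in the product at \<open>x\<close> and in an open set \<open>V\<close>.
  Membership in \<open>V\<close> is guaranteed by agreement with \<open>g\<close> on initial segments \<open>{..<N i}\<close> at the
  coordinates \<open>i\<close> of a finite set \<open>I\<close>. Near \<open>x\<close>, each \<open>\<phi> y i\<close> still contains the finitely many
  points of \<open>g i\<close> below \<open>N i\<close>, and removing its other points below \<open>N i\<close> yields the required
  agreement.
\<close>

lemma lower_semicontinuous_frechet_subsets_iff: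
  fixes X :: "'a topology"
  assumes \<phi>: "\<And>x k. x \<in> topspace X \<Longrightarrow> \<phi> x k \<in> frechet"
  shows "lower_semicontinuous X frechet_power (\<lambda>x. \<Pi>\<^sub>E k\<in>UNIV. Pow (\<phi> x k) \<inter> frechet) \<longleftrightarrow>
    (\<forall>k n. openin X {x \<in> topspace X. n \<in> \<phi> x k})"
    (is "lower_semicontinuous X _ ?\<Phi> \<longleftrightarrow> _")
proof (intro iffI allI)
  fix k n
  assume lsc: "lower_semicontinuous X frechet_power ?\<Phi>"
  let ?V = "{g \<in> topspace frechet_power. n \<in> g k}"
  have "openin X {x \<in> topspace X. ?\<Phi> x \<inter> ?V \<noteq> {}}"
    using lsc openin_frechet_power_mem unfolding lower_semicontinuous_def by blast
  also have "{x \<in> topspace X. ?\<Phi> x \<inter> ?V \<noteq> {}} = {x \<in> topspace X. n \<in> \<phi> x k}"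
  proof (intro Collect_cong conj_cong refl iffI)
    fix x assume "?\<Phi> x \<inter> ?V \<noteq> {}"
    then show "n \<in> \<phi> x k"
      by (fastforce simp: PiE_iff)
  next
    fix x assume "x \<in> topspace X" "n \<in> \<phi> x k"
    then have "\<phi> x \<in> ?\<Phi> x \<inter> ?V"
      using \<phi> by (auto simp: topspace_frechet_power PiE_iff)
    then show "?\<Phi> x \<inter> ?V \<noteq> {}" by blast
  qed
  finally show "openin X {x \<in> topspace X. n \<in> \<phi> x k}" .
next
  assume op: "\<forall>k n. openin X {x \<in> topspace X. n \<in> \<phi> x k}"
  show "lower_semicontinuous X frechet_power ?\<Phi>"
    unfolding lower_semicontinuous_def
  proof (intro conjI allI impI)
    show "?\<Phi> \<in> topspace X \<rightarrow> Pow (topspace frechet_power)"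
      by (auto simp: topspace_frechet_power PiE_iff)
  next
    fix V assume V: "openin frechet_power V"
    show "openin X {x \<in> topspace X. ?\<Phi> x \<inter> V \<noteq> {}}" (is "openin X ?S")
    proof (subst openin_subopen, intro ballI)
      fix x assume "x \<in> ?S"
      then obtain g where x: "x \<in> topspace X" and g: "g \<in> ?\<Phi> x" "g \<in> V" by auto
      obtain U where U: "finite {i. U i \<noteq> frechet}" "\<And>i. openin frechet_space (U i)"
          "g \<in> Pi\<^sub>E UNIV U" "Pi\<^sub>E UNIV U \<subseteq> V"
        using V g(2) unfolding frechet_power_def openin_product_topology_alt
        by (auto simp: topspace_frechet_space)
      define I where "I = {i. U i \<noteq> frechet}"
      have "\<exists>N. \<forall>B. B \<in> frechet \<longrightarrow> B \<inter> {..<N} = g i \<inter> {..<N} \<longrightarrow> B \<in> U i" for i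
        using openin_frechet_space_initial_segment[OF U(2), of "g i" i] U(3)
        by (metis PiE_mem UNIV_I)
      then obtain N where
        N: "\<And>i B. B \<in> frechet \<Longrightarrow> B \<inter> {..<N i} = g i \<inter> {..<N i} \<Longrightarrow> B \<in> U i"
        by metis
      define P where "P = (SIGMA i:I. g i \<inter> {..<N i :: nat})"
      \<comment> \<open>Including the whole space keeps the family nonempty when there are no conditions.\<close>
      define W where
        "W = \<Inter>(insert (topspace X) ((\<lambda>(i, n). {y \<in> topspace X. n \<in> \<phi> y i}) ` P))"
      have "finite P"
        using U(1) by (auto simp: P_def I_def)
      then have "openin X W"
        unfolding W_def using op by (intro openin_Inter) auto
      moreover have "x \<in> W"
        using x g(1) by (fastforce simp: W_def P_def PiE_iff)
      moreover have "W \<subseteq> ?S"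
      proof
        fix y assume "y \<in> W"
        then have y: "y \<in> topspace X" and sub: "\<And>i. i \<in> I \<Longrightarrow> g i \<inter> {..<N i} \<subseteq> \<phi> y i"
          by (auto simp: W_def P_def)
        define h where "h = (\<lambda>i. if i \<in> I then \<phi> y i - ({..<N i} - g i) else \<phi> y i)"
        have h_frechet: "h i \<in> frechet" for i
          using \<phi>[OF y, of i] by (auto simp: h_def frechet_def Compl_Diff_eq)
        have "h i \<in> U i" for i
        proof (cases "i \<in> I")
          case True
          then have "h i \<inter> {..<N i} = g i \<inter> {..<N i}"
            using sub[OF True] by (auto simp: h_def)
          then show ?thesis using N h_frechet by blast
        next
          case False
          then show ?thesis using h_frechet[of i] by (simp add: I_def)
        qed
        then have "h \<in> V" using U(4) by auto
        moreover have "h \<in> ?\<Phi> y"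
          using h_frechet by (auto simp: h_def PiE_iff split: if_splits)
        ultimately show "y \<in> ?S" using y by blast
      qed
      ultimately show "\<exists>T. openin X T \<and> x \<in> T \<and> T \<subseteq> ?S" by blast
    qed
  qed
qed

lemma mem_frechet_iff_cofinite: "A \<in> frechet \<longleftrightarrow> (\<forall>\<^sub>\<infinity>n. n \<in> A)"
  by (simp add: frechet_def eventually_cofinite Compl_eq)

theorem S1_open_gamma_covers_iff_frechet_lower_semicontinuous:
  fixes X :: "'a topology"
  shows "S1 (open_gamma_covers X) (open_gamma_covers X) \<longleftrightarrow>
    (\<forall>\<phi> :: 'a \<Rightarrow> nat \<Rightarrow> nat set.
       \<phi> \<in> topspace X \<rightarrow> topspace frechet_power \<and>
       lower_semicontinuous X frechet_power (\<lambda>x. \<Pi>\<^sub>E k\<in>UNIV. Pow (\<phi> x k) \<inter> frechet) \<longrightarrow>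
       (\<exists>f :: nat \<Rightarrow> nat. \<forall>x\<in>topspace X. \<forall>\<^sub>\<infinity>k. f k \<in> \<phi> x k))"
    (is "_ \<longleftrightarrow> (\<forall>\<phi>. ?lsc \<phi> \<longrightarrow> ?sel \<phi>)")
proof (intro iffI allI impI)
  fix \<phi> :: "'a \<Rightarrow> nat \<Rightarrow> nat set"
  assume S1: "S1 (open_gamma_covers X) (open_gamma_covers X)" and "?lsc \<phi>"
  then have fr: "\<And>x k. x \<in> topspace X \<Longrightarrow> \<phi> x k \<in> frechet"
    and lsc: "lower_semicontinuous X frechet_power (\<lambda>x. \<Pi>\<^sub>E k\<in>UNIV. Pow (\<phi> x k) \<inter> frechet)"
    by (auto simp: topspace_frechet_power)
  define U where "U = (\<lambda>k n. {x \<in> topspace X. n \<in> \<phi> x k})"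
  have "U k \<in> open_gamma_covers X" for k
    using fr lower_semicontinuous_frechet_subsets_iff[of X \<phi>] lsc
    by (auto simp: open_gamma_covers_def gamma_cover_def U_def mem_frechet_iff_cofinite)
  then obtain V where V: "\<And>k. V k \<in> range (U k)" "V \<in> open_gamma_covers X"
    using S1 unfolding S1_def by meson
  have "\<forall>k. \<exists>n. V k = U k n"
    using V(1) by blast
  then obtain f where "\<forall>k. V k = U k (f k)"
    by (rule exE[OF choice])
  then show "?sel \<phi>"
    using V(2) by (intro exI[of _ f]) (auto simp: open_gamma_covers_def gamma_cover_def U_def)
next
  assume sel: "\<forall>\<phi>. ?lsc \<phi> \<longrightarrow> ?sel \<phi>"
  show "S1 (open_gamma_covers X) (open_gamma_covers X)"
    unfolding S1_def
  proof (intro allI impI)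
    fix U :: "nat \<Rightarrow> nat \<Rightarrow> 'a set"
    assume U: "\<forall>k. U k \<in> open_gamma_covers X"
    have cover: "\<forall>\<^sub>\<infinity>n. x \<in> U k n" if "x \<in> topspace X" for x k
      using spec[OF U, of k] that by (simp add: open_gamma_covers_def gamma_cover_def)
    have op: "openin X (U k n)" for k n
      using spec[OF U, of k] by (simp add: open_gamma_covers_def)
    define \<phi> where "\<phi> = (\<lambda>x k. {n. x \<in> U k n})"
    have fr: "\<phi> x k \<in> frechet" if "x \<in> topspace X" for x k
      using cover[OF that] by (simp add: \<phi>_def mem_frechet_iff_cofinite)
    have "{x \<in> topspace X. n \<in> \<phi> x k} = U k n" for k n
      using openin_subset[OF op] by (auto simp: \<phi>_def)
    then have "?lsc \<phi>"
      using fr op lower_semicontinuous_frechet_subsets_iff[of X \<phi>]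
      by (auto simp: topspace_frechet_power)
    then obtain f where "\<forall>x\<in>topspace X. \<forall>\<^sub>\<infinity>k. f k \<in> \<phi> x k"
      using sel by blast
    then have "(\<lambda>k. U k (f k)) \<in> open_gamma_covers X"
      using op openin_subset[OF op]
      by (simp add: open_gamma_covers_def gamma_cover_def \<phi>_def)
    then show "\<exists>V. (\<forall>k. V k \<in> range (U k)) \<and> V \<in> open_gamma_covers X"
      by (intro exI[of _ "\<lambda>k. U k (f k)"]) auto
  qed
qed

theorem theorem19:
  fixes X :: "real set"
  assumes "clopen_separation (top_of_set X)"
  shows "S1 (open_gamma_covers (top_of_set X)) (open_gamma_covers (top_of_set X)) \<longleftrightarrow>
    (\<forall>\<phi> :: real \<Rightarrow> nat \<Rightarrow> nat set.
       \<phi> \<in> X \<rightarrow> topspace frechet_power \<and>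
       lower_semicontinuous (top_of_set X) frechet_power
         (\<lambda>x. \<Pi>\<^sub>E k\<in>UNIV. Pow (\<phi> x k) \<inter> frechet) \<longrightarrow>
       (\<exists>f :: nat \<Rightarrow> nat. \<forall>x\<in>X. \<forall>\<^sub>\<infinity>k. f k \<in> \<phi> x k))"
  using S1_open_gamma_covers_iff_frechet_lower_semicontinuous[of "top_of_set X"] by simp

end
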